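(* Let $I=\langle\mathcal{A},\emptyset,\mathcal{R},\mathcal{R}^?\rangle$ be an AtIAF and $S\subseteq\mathcal{A}$ a set of arguments such that $S$ is not stable-$\mathtt{ad}$ w.r.t. $I$. For each attack $r=(a,b)\in\mathcal{R}^?$ such that $a\notin S$ or $b\notin S$: - $r\in RE^+(I,S,\mathtt{ad}\text{-}true)$ iff $a\in S$, $b\notin S_I^+$ and $S\not\subseteq\{b\}^{\sim}_I$; and - $r\in RE^-(I,S,\mathtt{ad}\text{-}true)$ iff $a\notin S_I^-$, $a\notin S_I^+$ and $b\in S$.
   Context: An argumentation framework (AF) is a pair $F=\langle \mathcal{A}_F,\mathcal{R}_F\rangle$ with $\mathcal{R}_F\subseteq\mathcal{A}_F\times\mathcal{A}_F$; $a$ attacks $b$ if $(a,b)\in\mathcal{R}_F$. A set $S\subseteq\mathcal{A}_F$ is conflict-free if no element of $S$ attacks an element of $S$; $S$ defends $a$ if every attacker of $a$ is attacked by some element of $S$; $S\in\mathtt{ad}(F)$ (admissible) iff $S$ is conflict-free and defends each of its elements. $S$ is $\mathtt{ad}$-$true$ in $F$ iff $S\in\mathtt{ad}(F)$. An incomplete argumentation framework (IAF) is $I=\langle\mathcal{A},\mathcal{A}^?,\mathcal{R},\mathcal{R}^?\rangle$ with $\mathcal{A},\mathcal{A}^?$ disjoint sets of (certain, uncertain) arguments and $\mathcal{R},\mathcal{R}^?$ disjoint subsets of $(\mathcal{A}\cup\mathcal{A}^?)\times(\mathcal{A}\cup\mathcal{A}^?)$ (certain, uncertain attacks). An AtIAF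 is an IAF with $\mathcal{A}^?=\emptyset$. A partial completion of $I$ is an IAF $I'=\langle\mathcal{A}',\mathcal{A}^{?'},\mathcal{R}',\mathcal{R}^{?'}\rangle$ with $\mathcal{A}\subseteq\mathcal{A}'\subseteq\mathcal{A}\cup\mathcal{A}^?$, $\mathcal{R}\cap((\mathcal{A}'\cup\mathcal{A}^{?'})\times(\mathcal{A}'\cup\mathcal{A}^{?'}))\subseteq\mathcal{R}'\subseteq\mathcal{R}\cup\mathcal{R}^?$, $\mathcal{A}^{?'}\subseteq\mathcal{A}^?$, $\mathcal{R}^{?'}\subseteq\mathcal{R}^?$; $part(I)$ is the set of partial completions. $cert(I)=\langle\mathcal{A},\mathcal{R}\cap(\mathcal{A}\times\mathcal{A})\rangle$. A completion of $I$ is an AF of the form $cert(I')$ with $I'\in part(I)$ (for an AtIAF: an AF $\langle\mathcal{A},\mathcal{R}_F\rangle$ with $\mathcal{R}\subseteq\mathcal{R}_F\subseteq\mathcal{R}\cup\mathcal{R}^?$). For $\mathcal{R}_0\subseteq\mathcal{R}^?$: $I+\mathcal{R}_0=\langle\mathcal{A},\mathcal{A}^?,\mathcal{R}\cup\mathcal{R}_0,\mathcal{R}^?\setminus\mathcal{R}_0\rangle$ and $I-\mathcal{R}_0=\langle\mathcal{A},\mathcal{A}^?,\mathcal{R},\mathcal{R}^?\setminus\mathcal{R}_0\rangle$. For $S\subseteq\mathcal{A}\cup\mathcal{A}^?$: $S_I^+=\{a\in\mathcal{A}\cup\mathcal{A}^?\mid\exists b\in S,(b,a)\in\mathcal{R}\}$,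 $S_I^-=\{a\in\mathcal{A}\cup\mathcal{A}^?\mid\exists b\in S,(a,b)\in\mathcal{R}\}$, $S_I^{\sim}=\{a\in\mathcal{A}\cup\mathcal{A}^?\mid\forall b\in S,(b,a)\notin\mathcal{R}\cup\mathcal{R}^?\}$. $S$ is stable-$\mathtt{ad}$ w.r.t. $I$ iff either $S\in\mathtt{ad}(F)$ for every completion $F$ of $I$, or $S\notin\mathtt{ad}(F)$ for every completion $F$ of $I$. Relevance: for $e\in\mathcal{R}^?$, $e\in RE^+(I,S,\mathtt{ad}\text{-}true)$ (resp. $e\in RE^-(I,S,\mathtt{ad}\text{-}true)$) iff there is $I'=\langle\mathcal{A}',\mathcal{A}^{?'},\mathcal{R}',\mathcal{R}^{?'}\rangle\in part(I)$ with $\mathcal{A}^{?'}\cup\mathcal{R}^{?'}=\{e\}$ such that $S$ is $\mathtt{ad}$-$true$ in $cert(I'+\{e\})$ (resp. $cert(I'-\{e\})$) and $S$ is not $\mathtt{ad}$-$true$ in $cert(I'-\{e\})$ (resp. $cert(I'+\{e\})$). *)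

theory Defs
  imports Main
begin

record 'a af =
  af_args :: "'a set"
  af_atts :: "('a \<times> 'a) set"

definition wf_af :: "'a af \<Rightarrow> bool" where
  "wf_af F \<longleftrightarrow> af_atts F \<subseteq> af_args F \<times> af_args F"

definition conflict_free :: "'a af \<Rightarrow> 'a set \<Rightarrow> bool" where
  "conflict_free F S \<longleftrightarrow> (\<forall>a\<in>S. \<forall>b\<in>S. (a, b) \<notin> af_atts F)"

definition defends :: "'a af \<Rightarrow> 'a set \<Rightarrow> 'a \<Rightarrow> bool" where
  "defends F S a \<longleftrightarrow>
     (\<forall>b\<in>af_args F. (b, a) \<in> af_atts F \<longrightarrow> (\<exists>c\<in>S. (c, b) \<in> af_atts F))"

definition ad :: "'a af \<Rightarrow> 'a set set" where
  "ad F = {S. S \<subseteq> af_args F \<and> conflict_free F S \<and> (\<forall>a\<in>S. defends F S a)}"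

definition ad_true :: "'a set \<Rightarrow> 'a af \<Rightarrow> bool" where
  "ad_true S F \<longleftrightarrow> S \<in> ad F"

text \<open>Incomplete frameworks; the prefix \<open>u\<close> marks the uncertain components.\<close>

record 'a iaf =
  args :: "'a set"
  uargs :: "'a set"
  atts :: "('a \<times> 'a) set"
  uatts :: "('a \<times> 'a) set"

definition wf_iaf :: "'a iaf \<Rightarrow> bool" where
  "wf_iaf I \<longleftrightarrow>
     args I \<inter> uargs I = {} \<and>
     atts I \<inter> uatts I = {} \<and>
     atts I \<subseteq> (args I \<union> uargs I) \<times> (args I \<union> uargs I) \<and>
     uatts I \<subseteq> (args I \<union> uargs I) \<times> (args I \<union> uargs I)"

definition at_iaf :: "'a iaf \<Rightarrow> bool" where
  "at_iaf I \<longleftrightarrow> wf_iaf I \<and> uargs I = {}"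

definition part :: "'a iaf \<Rightarrow> 'a iaf set" where
  "part I = {I'. wf_iaf I' \<and>
     args I \<subseteq> args I' \<and> args I' \<subseteq> args I \<union> uargs I \<and>
     atts I \<inter> ((args I' \<union> uargs I') \<times> (args I' \<union> uargs I')) \<subseteq> atts I' \<and>
     atts I' \<subseteq> atts I \<union> uatts I \<and>
     uargs I' \<subseteq> uargs I \<and>
     uatts I' \<subseteq> uatts I}"

definition cert :: "'a iaf \<Rightarrow> 'a af" where
  "cert I = \<lparr>af_args = args I, af_atts = atts I \<inter> (args I \<times> args I)\<rparr>"

definition completions :: "'a iaf \<Rightarrow> 'a af set" where
  "completions I = cert ` part I"

lemma wf_af_completion: "F \<in> completions I \<Longrightarrow> wf_af F"
  by (auto simp: completions_def cert_def wf_af_def)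

lemma completions_at_iaf:
  assumes "at_iaf I"
  shows "completions I =
    {F. af_args F = args I \<and> atts I \<subseteq> af_atts F \<and> af_atts F \<subseteq> atts I \<union> uatts I}"
proof (intro equalityI subsetI)
  fix F :: "'a af" assume "F \<in> completions I"
  then show "F \<in> {F. af_args F = args I \<and> atts I \<subseteq> af_atts F \<and> af_atts F \<subseteq> atts I \<union> uatts I}"
    using assms by (fastforce simp: completions_def cert_def part_def at_iaf_def wf_iaf_def)
next
  fix F :: "'a af"
  assume F: "F \<in> {F. af_args F = args I \<and> atts I \<subseteq> af_atts F \<and> af_atts F \<subseteq> atts I \<union> uatts I}"
  let ?J = "\<lparr>args = args I, uargs = {}, atts = af_atts F, uatts = {}\<rparr>"
  have sub: "af_atts F \<subseteq> args I \<times> args I"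
    using assms F unfolding at_iaf_def wf_iaf_def by blast
  have "?J \<in> part I"
    using assms F sub by (auto simp: part_def at_iaf_def wf_iaf_def)
  moreover have "F = cert ?J"
    using F sub by (cases F) (auto simp: cert_def)
  ultimately show "F \<in> completions I"
    unfolding completions_def by blast
qed

definition stable_ad :: "'a iaf \<Rightarrow> 'a set \<Rightarrow> bool" where
  "stable_ad I S \<longleftrightarrow>
     (\<forall>F\<in>completions I. S \<in> ad F) \<or> (\<forall>F\<in>completions I. S \<notin> ad F)"

definition add_atts :: "'a iaf \<Rightarrow> ('a \<times> 'a) set \<Rightarrow> 'a iaf" where
  "add_atts I R = I\<lparr>atts := atts I \<union> R, uatts := uatts I - R\<rparr>"

definition remove_atts :: "'a iaf \<Rightarrow> ('a \<times> 'a) set \<Rightarrow> 'a iaf" where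
  "remove_atts I R = I\<lparr>uatts := uatts I - R\<rparr>"

definition attacked_by :: "'a iaf \<Rightarrow> 'a set \<Rightarrow> 'a set" where  \<comment> \<open>\<open>S\<^sup>+\<close>\<close>
  "attacked_by I S = {a \<in> args I \<union> uargs I. \<exists>b\<in>S. (b, a) \<in> atts I}"

definition attackers_of :: "'a iaf \<Rightarrow> 'a set \<Rightarrow> 'a set" where  \<comment> \<open>\<open>S\<^sup>-\<close>\<close>
  "attackers_of I S = {a \<in> args I \<union> uargs I. \<exists>b\<in>S. (a, b) \<in> atts I}"

definition never_attacked_by :: "'a iaf \<Rightarrow> 'a set \<Rightarrow> 'a set" where  \<comment> \<open>\<open>S\<^sup>\<sim>\<close>\<close>
  "never_attacked_by I S =
     {a \<in> args I \<union> uargs I. \<forall>b\<in>S. (b, a) \<notin> atts I \<union> uatts I}"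

text \<open>
  Relevance of an uncertain attack for a property \<open>P\<close> of a set of arguments in a
  framework. Arguments and attacks have different types, so the set of all uncertain
  elements of an incomplete framework is the disjoint sum \<open>uargs I <+> uatts I\<close>.
\<close>

definition RE_plus :: "'a iaf \<Rightarrow> 'a set \<Rightarrow> ('a set \<Rightarrow> 'a af \<Rightarrow> bool) \<Rightarrow> ('a \<times> 'a) set" where
  "RE_plus I S P = {e \<in> uatts I. \<exists>I'\<in>part I. uargs I' <+> uatts I' = {Inr e} \<and>
     P S (cert (add_atts I' {e})) \<and> \<not> P S (cert (remove_atts I' {e}))}"

definition RE_minus :: "'a iaf \<Rightarrow> 'a set \<Rightarrow> ('a set \<Rightarrow> 'a af \<Rightarrow> bool) \<Rightarrow> ('a \<times> 'a) set" where
  "RE_minus I S P = {e \<in> uatts I. \<exists>I'\<in>part I. uargs I' <+> uatts I' = {Inr e} \<and>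
     P S (cert (remove_atts I' {e})) \<and> \<not> P S (cert (add_atts I' {e}))}"

end

theory Submission
  imports Defs
begin

text \<open>
  In a framework with certain arguments only, relevance of an attack \<open>e\<close> compares two completions
  with attack sets \<open>Q\<close> and \<open>insert e Q\<close>. The attacks from \<open>S\<close> to its complement can only help
  \<open>S\<close> to be admissible. Since some completion makes \<open>S\<close> admissible, so does the completion
  containing all possible attacks from \<open>S\<close> to its complement and no other uncertain attack.
  The witness for \<open>RE_plus\<close> drops the uncertain attacks on \<open>b\<close> and adds an attack from \<open>b\<close> on
  \<open>S\<close>, so that \<open>(a, b)\<close> is the only defence against \<open>b\<close>. The witness for \<open>RE_minus\<close> drops the
  uncertain attacks on \<open>a\<close>, so that there is no defence against \<open>(a, b)\<close>.
\<close>

lemma at_iaf_attacks_subset: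
  "at_iaf I \<Longrightarrow> atts I \<union> uatts I \<subseteq> args I \<times> args I"
  unfolding at_iaf_def wf_iaf_def by auto

text \<open>Without uncertain arguments, a partial completion whose only uncertain element is
  \<open>e\<close> is determined by its certain attacks \<open>Q\<close>. Taking \<open>P\<close> on
  both frameworks at once covers \<open>RE_plus\<close> and \<open>RE_minus\<close> alike.\<close>

lemma single_uncertain_attack_iff:
  assumes "at_iaf I" and "e \<in> uatts I"
  shows "(\<exists>I'\<in>part I. uargs I' <+> uatts I' = {Inr e} \<and>
            P (cert (add_atts I' {e})) (cert (remove_atts I' {e}))) \<longleftrightarrow>
         (\<exists>Q. atts I \<subseteq> Q \<and> Q \<subseteq> atts I \<union> uatts I - {e} \<and>
            P \<lparr>af_args = args I, af_atts = insert e Q\<rparr> \<lparr>af_args = args I, af_atts = Q\<rparr>)"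
    (is "?L \<longleftrightarrow> ?R")
proof
  assume ?L
  then obtain I' where I': "I' \<in> part I" "uargs I' <+> uatts I' = {Inr e}"
    and P: "P (cert (add_atts I' {e})) (cert (remove_atts I' {e}))"
    by blast
  have u: "uargs I' = {}" "uatts I' = {e}"
    using I'(2) by auto
  have args: "args I' = args I"
    and sub: "atts I' \<subseteq> args I \<times> args I" "e \<in> args I \<times> args I"
    using I'(1) u assms unfolding part_def at_iaf_def wf_iaf_def by auto
  have Q: "atts I \<subseteq> atts I'" "atts I' \<subseteq> atts I \<union> uatts I - {e}"
  proof -
    have "atts I \<inter> (args I \<times> args I) \<subseteq> atts I'" "atts I' \<subseteq> atts I \<union> uatts I"
      "atts I' \<inter> {e} = {}"
      using I'(1) args u by (simp_all add: part_def wf_iaf_def)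
    moreover have "atts I \<subseteq> args I \<times> args I"
      using at_iaf_attacks_subset[OF assms(1)] by blast
    ultimately show "atts I \<subseteq> atts I'" "atts I' \<subseteq> atts I \<union> uatts I - {e}"
      by blast+
  qed
  have "cert (add_atts I' {e}) = \<lparr>af_args = args I, af_atts = insert e (atts I')\<rparr>"
    "cert (remove_atts I' {e}) = \<lparr>af_args = args I, af_atts = atts I'\<rparr>"
    using args sub by (auto simp: cert_def add_atts_def remove_atts_def)
  with P Q show ?R by auto
next
  assume ?R
  then obtain Q where Q: "atts I \<subseteq> Q" "Q \<subseteq> atts I \<union> uatts I - {e}"
    and P: "P \<lparr>af_args = args I, af_atts = insert e Q\<rparr> \<lparr>af_args = args I, af_atts = Q\<rparr>"
    by blast
  let ?J = "\<lparr>args = args I, uargs = {}, atts = Q, uatts = {e}\<rparr>"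
  have sub: "Q \<subseteq> args I \<times> args I" "e \<in> args I \<times> args I"
    using Q at_iaf_attacks_subset[OF assms(1)] assms(2) by blast+
  have "?J \<in> part I"
    using Q assms sub by (auto simp: part_def at_iaf_def wf_iaf_def)
  moreover have "cert (add_atts ?J {e}) = \<lparr>af_args = args I, af_atts = insert e Q\<rparr>"
    "cert (remove_atts ?J {e}) = \<lparr>af_args = args I, af_atts = Q\<rparr>"
    using sub by (auto simp: cert_def add_atts_def remove_atts_def)
  ultimately show ?L
    using P by (intro bexI[of _ ?J]) auto
qed

lemma RE_plus_iff:
  assumes "at_iaf I" and "e \<in> uatts I"
  shows "e \<in> RE_plus I S P \<longleftrightarrow>
    (\<exists>Q. atts I \<subseteq> Q \<and> Q \<subseteq> atts I \<union> uatts I - {e} \<and>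
      P S \<lparr>af_args = args I, af_atts = insert e Q\<rparr> \<and>
      \<not> P S \<lparr>af_args = args I, af_atts = Q\<rparr>)"
  using single_uncertain_attack_iff[OF assms, of "\<lambda>F G. P S F \<and> \<not> P S G"] assms(2)
  by (simp add: RE_plus_def)

lemma RE_minus_iff:
  assumes "at_iaf I" and "e \<in> uatts I"
  shows "e \<in> RE_minus I S P \<longleftrightarrow>
    (\<exists>Q. atts I \<subseteq> Q \<and> Q \<subseteq> atts I \<union> uatts I - {e} \<and>
      P S \<lparr>af_args = args I, af_atts = Q\<rparr> \<and>
      \<not> P S \<lparr>af_args = args I, af_atts = insert e Q\<rparr>)"
  using single_uncertain_attack_iff[OF assms, of "\<lambda>F G. P S G \<and> \<not> P S F"] assms(2)
  by (simp add: RE_minus_def)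

lemma ad_true_iff:
  assumes "wf_af F" and "S \<subseteq> af_args F"
  shows "ad_true S F \<longleftrightarrow>
    af_atts F \<inter> S \<times> S = {} \<and>
    (\<forall>x s. s \<in> S \<longrightarrow> (x, s) \<in> af_atts F \<longrightarrow> (\<exists>c\<in>S. (c, x) \<in> af_atts F))"
  using assms unfolding ad_true_def ad_def conflict_free_def defends_def wf_af_def by blast

text \<open>Non-stability yields a completion in which \<open>S\<close> is admissible. Its attacks
  lie between \<open>atts I\<close> and \<open>atts I \<union> uatts I\<close>, so conflict-freeness
  passes down to the certain attacks and defenders pass up to the possible ones.\<close>

lemma not_stable_adE:
  assumes "at_iaf I" and "S \<subseteq> args I" and "\<not> stable_ad I S"
  obtains "atts I \<inter> S \<times> S = {}"
    and "\<And>x s. s \<in> S \<Longrightarrow> (x, s) \<in> atts I \<Longrightarrow> x \<notin> S \<and> (\<exists>c\<in>S. (c, x) \<in> atts I \<union> uatts I)"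
proof -
  obtain F where F: "F \<in> completions I" "ad_true S F"
    using assms(3) by (auto simp: stable_ad_def ad_true_def)
  have atts: "af_args F = args I" "atts I \<subseteq> af_atts F" "af_atts F \<subseteq> atts I \<union> uatts I"
    using F(1) completions_at_iaf[OF assms(1)] by auto
  have "af_atts F \<inter> S \<times> S = {}"
    and "\<And>x s. s \<in> S \<Longrightarrow> (x, s) \<in> af_atts F \<Longrightarrow> \<exists>c\<in>S. (c, x) \<in> af_atts F"
    using F(2) ad_true_iff[OF wf_af_completion[OF F(1)]] assms(2) atts(1) by auto
  with atts(2,3) show thesis by (intro that) blast+
qed

theorem proposition3:
  fixes I :: "'a iaf" and S :: "'a set" and a b :: 'a
  assumes "at_iaf I"
    and "S \<subseteq> args I"
    and "\<not> stable_ad I S"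
    and "(a, b) \<in> uatts I"
    and "a \<notin> S \<or> b \<notin> S"
  shows "((a, b) \<in> RE_plus I S ad_true \<longleftrightarrow>
            a \<in> S \<and> b \<notin> attacked_by I S \<and> \<not> S \<subseteq> never_attacked_by I {b}) \<and>
         ((a, b) \<in> RE_minus I S ad_true \<longleftrightarrow>
            a \<notin> attackers_of I S \<and> a \<notin> attacked_by I S \<and> b \<in> S)"
proof -
  have sub: "atts I \<union> uatts I \<subseteq> args I \<times> args I"
    using at_iaf_attacks_subset[OF assms(1)] .
  have disj: "(a, b) \<notin> atts I"
    using assms(1,4) unfolding at_iaf_def wf_iaf_def by auto
  have attacked_by: "x \<in> attacked_by I S \<longleftrightarrow> (\<exists>c\<in>S. (c, x) \<in> atts I)" for x
    using sub by (auto simp: attacked_by_def)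
  have attackers_of: "x \<in> attackers_of I S \<longleftrightarrow> (\<exists>c\<in>S. (x, c) \<in> atts I)" for x
    using sub by (auto simp: attackers_of_def)
  have never_attacked: "\<not> S \<subseteq> never_attacked_by I {b} \<longleftrightarrow> (\<exists>s\<in>S. (b, s) \<in> atts I \<union> uatts I)"
    using assms(2) by (auto simp: never_attacked_by_def)
  let ?F = "\<lambda>Q. \<lparr>af_args = args I, af_atts = Q\<rparr>"
  have adm: "ad_true S (?F Q) \<longleftrightarrow> Q \<inter> S \<times> S = {} \<and>
      (\<forall>x s. s \<in> S \<longrightarrow> (x, s) \<in> Q \<longrightarrow> (\<exists>c\<in>S. (c, x) \<in> Q))"
    if "Q \<subseteq> atts I \<union> uatts I" for Q
    using ad_true_iff[of "?F Q" S] order_trans[OF that sub] assms(2) by (simp add: wf_af_def)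
  obtain cf: "atts I \<inter> S \<times> S = {}"
    and def_S: "\<And>x s. s \<in> S \<Longrightarrow> (x, s) \<in> atts I \<Longrightarrow>
      x \<notin> S \<and> (\<exists>c\<in>S. (c, x) \<in> atts I \<union> uatts I)"
    using not_stable_adE[OF assms(1-3)] by blast
  show ?thesis
  proof (intro conjI iffI)
    assume "(a, b) \<in> RE_plus I S ad_true"
    then obtain Q where Q: "atts I \<subseteq> Q" "Q \<subseteq> atts I \<union> uatts I - {(a, b)}"
      and ad: "ad_true S (?F (insert (a, b) Q))" "\<not> ad_true S (?F Q)"
      unfolding RE_plus_iff[OF assms(1,4)] by blast
    have ins: "insert (a, b) Q \<inter> S \<times> S = {}"
      "\<And>x s. s \<in> S \<Longrightarrow> (x, s) \<in> Q \<Longrightarrow> \<exists>c\<in>S. (c, x) \<in> insert (a, b) Q"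
      using ad(1) adm[of "insert (a, b) Q"] Q assms(4) by auto
    \<comment> \<open>Conflict-freeness is inherited by \<open>Q\<close>, so admissibility can fail
      there only at an undefended attacker \<open>x\<close>.\<close>
    obtain x s where xs: "s \<in> S" "(x, s) \<in> Q" "\<forall>c\<in>S. (c, x) \<notin> Q"
      using ad(2) adm[of Q] Q(2) ins(1) by blast
    \<comment> \<open>\<open>x\<close> is countered once \<open>(a, b)\<close> is added but not
      before, so \<open>(a, b)\<close> is itself the counterattack.\<close>
    then have "x = b" "a \<in> S" using ins(2)[of s x] by auto
    with xs Q show "a \<in> S" "b \<notin> attacked_by I S" "\<not> S \<subseteq> never_attacked_by I {b}"
      unfolding attacked_by never_attacked by blast+
  next
    assume *: "a \<in> S \<and> b \<notin> attacked_by I S \<and> \<not> S \<subseteq> never_attacked_by I {b}"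
    then obtain s where s: "s \<in> S" "(b, s) \<in> atts I \<union> uatts I"
      unfolding never_attacked by blast
    have "b \<notin> S" using * assms(5) by blast
    \<comment> \<open>The attack \<open>(b, s)\<close> creates the need for a defence. It starts
      outside \<open>S\<close>, hence causes no conflict and cannot be the missing counterattack on
      \<open>b\<close>.\<close>
    define Q where "Q = insert (b, s) (atts I \<union> (uatts I \<inter> S \<times> - S - UNIV \<times> {b}))"
    have Q: "atts I \<subseteq> Q" "Q \<subseteq> atts I \<union> uatts I - {(a, b)}"
      using s disj \<open>b \<notin> S\<close> by (auto simp: Q_def)
    have "ad_true S (?F (insert (a, b) Q))"
    proof (subst adm)
      show "insert (a, b) Q \<subseteq> atts I \<union> uatts I" using Q assms(4) by blast
      have "insert (a, b) Q \<inter> S \<times> S = {}"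
        using cf \<open>b \<notin> S\<close> by (auto simp: Q_def)
      moreover have "\<exists>c\<in>S. (c, x) \<in> insert (a, b) Q"
        if "t \<in> S" "(x, t) \<in> insert (a, b) Q" for x t
      proof (cases "x = b")
        case True
        with * show ?thesis by blast
      next
        case False
        \<comment> \<open>Every added attack other than \<open>(b, s)\<close> ends outside
          \<open>S\<close>. The counterattack on \<open>x\<close> from \<open>def_S\<close> is kept
          in \<open>Q\<close>, since \<open>x\<close> is neither in \<open>S\<close> nor equal to
          \<open>b\<close>.\<close>
        then have "(x, t) \<in> atts I"
          using that \<open>b \<notin> S\<close> by (auto simp: Q_def)
        with def_S[OF \<open>t \<in> S\<close>] False show ?thesis by (auto simp: Q_def)
      qed
      ultimately show "insert (a, b) Q \<inter> S \<times> S = {} \<and>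
        (\<forall>x s. s \<in> S \<longrightarrow> (x, s) \<in> insert (a, b) Q \<longrightarrow> (\<exists>c\<in>S. (c, x) \<in> insert (a, b) Q))"
        by blast
    qed
    moreover have "\<not> ad_true S (?F Q)"
    proof
      assume "ad_true S (?F Q)"
      then obtain c where "c \<in> S" "(c, b) \<in> Q"
        using adm[of Q] Q(2) s(1) by (auto simp: Q_def)
      with * \<open>b \<notin> S\<close> s(1) show False unfolding attacked_by by (auto simp: Q_def)
    qed
    ultimately show "(a, b) \<in> RE_plus I S ad_true"
      unfolding RE_plus_iff[OF assms(1,4)] using Q by blast
  next
    assume "(a, b) \<in> RE_minus I S ad_true"
    then obtain Q where Q: "atts I \<subseteq> Q" "Q \<subseteq> atts I \<union> uatts I - {(a, b)}"
      and ad: "ad_true S (?F Q)" "\<not> ad_true S (?F (insert (a, b) Q))"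
      unfolding RE_minus_iff[OF assms(1,4)] by blast
    have del: "Q \<inter> S \<times> S = {}"
      "\<And>x s. s \<in> S \<Longrightarrow> (x, s) \<in> Q \<Longrightarrow> \<exists>c\<in>S. (c, x) \<in> Q"
      using ad(1) adm[of Q] Q by auto
    have "insert (a, b) Q \<subseteq> atts I \<union> uatts I" using Q assms(4) by blast
    moreover have "insert (a, b) Q \<inter> S \<times> S = {}" using del(1) assms(5) by blast
    ultimately obtain x s where xs: "s \<in> S" "(x, s) \<in> insert (a, b) Q"
      "\<forall>c\<in>S. (c, x) \<notin> insert (a, b) Q"
      using ad(2) adm[of "insert (a, b) Q"] by blast
    \<comment> \<open>Attacks in \<open>Q\<close> on \<open>S\<close> are already countered within
      \<open>Q\<close>, so the undefended one is \<open>(a, b)\<close>.\<close>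
    then have "x = a" "b \<in> S" using del(2)[of s x] by auto
    \<comment> \<open>A certain attack from \<open>a\<close> on \<open>S\<close> would be countered
      within \<open>Q\<close>, and the same counterattack would answer
      \<open>(a, b)\<close>.\<close>
    with xs del(2) Q show "a \<notin> attackers_of I S" "a \<notin> attacked_by I S" "b \<in> S"
      unfolding attacked_by attackers_of by blast+
  next
    assume *: "a \<notin> attackers_of I S \<and> a \<notin> attacked_by I S \<and> b \<in> S"
    have "a \<notin> S" using * assms(5) by blast
    define Q where "Q = atts I \<union> (uatts I \<inter> S \<times> - S - UNIV \<times> {a})"
    have Q: "atts I \<subseteq> Q" "Q \<subseteq> atts I \<union> uatts I - {(a, b)}"
      using disj \<open>a \<notin> S\<close> by (auto simp: Q_def)
    have "ad_true S (?F Q)"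
    proof (subst adm)
      show "Q \<subseteq> atts I \<union> uatts I" using Q by blast
      have "Q \<inter> S \<times> S = {}"
        using cf by (auto simp: Q_def)
      moreover have "\<exists>c\<in>S. (c, x) \<in> Q" if "t \<in> S" "(x, t) \<in> Q" for x t
      proof -
        have "(x, t) \<in> atts I" using that by (auto simp: Q_def)
        \<comment> \<open>Because \<open>a\<close> has no certain attack on \<open>S\<close>,
          dropping the uncertain attacks on \<open>a\<close> removes no counterattack that
          \<open>S\<close> needs.\<close>
        moreover from this have "x \<noteq> a"
          using * \<open>t \<in> S\<close> unfolding attackers_of by blast
        ultimately show ?thesis using def_S[OF \<open>t \<in> S\<close>] by (auto simp: Q_def)
      qed
      ultimately show "Q \<inter> S \<times> S = {} \<and>
        (\<forall>x s. s \<in> S \<longrightarrow> (x, s) \<in> Q \<longrightarrow> (\<exists>c\<in>S. (c, x) \<in> Q))"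
        by blast
    qed
    moreover have "\<not> ad_true S (?F (insert (a, b) Q))"
    proof
      assume "ad_true S (?F (insert (a, b) Q))"
      moreover have "insert (a, b) Q \<subseteq> atts I \<union> uatts I" using Q assms(4) by blast
      ultimately obtain c where "c \<in> S" "(c, a) \<in> insert (a, b) Q"
        using adm[of "insert (a, b) Q"] * by blast
      \<comment> \<open>Only a certain attack could put \<open>(c, a)\<close> into \<open>Q\<close>.
        If \<open>(c, a)\<close> were the new attack \<open>(a, b)\<close>, then
        \<open>c = a\<close>, which is outside \<open>S\<close>.\<close>
      with * \<open>a \<notin> S\<close> show False unfolding attacked_by by (auto simp: Q_def)
    qed
    ultimately show "(a, b) \<in> RE_minus I S ad_true"
      unfolding RE_minus_iff[OF assms(1,4)] using Q by blast
  qed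
qed

end
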